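(* Let $T$ be an $\mathcal{O}$-operator on a Hom-associative algebra $(A,\mu,\alpha)$ with respect to a bimodule $(M,l,r,\phi)$, and let $T^1_t=T+t\mathcal{T}_1$ and $T^2_t=T+t\mathcal{T}_2$ be two equivalent infinitesimal deformations of $T$. Then $\mathcal{T}_1$ and $\mathcal{T}_2$ define the same cohomology class in $H^1_\alpha(M,A)$.
   Context: All vector spaces are over a field $\mathbb{K}$. A Hom-associative algebra $(A,\mu,\alpha)$ (always multiplicative) is a vector space $A$ with a bilinear map $\mu$, written $\mu(a,b)=a\cdot b$, and a linear map $\alpha:A\to A$ such that $\alpha(a\cdot b)=\alpha(a)\cdot\alpha(b)$ and $\alpha(a)\cdot(b\cdot c)=(a\cdot b)\cdot\alpha(c)$ for all $a,b,c\in A$. A bimodule $(M,l,r,\phi)$ over $(A,\mu,\alpha)$ is a vector space $M$ with linear maps $\phi:M\to M$, $l:A\otimes M\to M$, $r:M\otimes A\to M$ such that for all $x,y\in A$, $v\in M$: $\phi l(x,v)=l(\alpha(x),\phi(v))$, $\phi r(v,x)=r(\phi(v),\alpha(x))$, $l(x\cdot y,\phi(v))=l(\alpha(x),l(y,v))$, $r(\phi(v),x\cdot y)=r(r(v,x),\alpha(y))$, $l(\alpha(x),r(v,y))=r(l(x,v),\alpha(y))$. An $\mathcal{O}$-operator on $A$ with respect to $M$ is a linear map $T:M\to A$ with $T\phi=\alpha T$ and $T(u)\cdot T(v)=T(l(T(u),v)+r(u,T(v)))$ for all $u,v\in M$. An infinitesimal deformation of $T$ is a sum $T_t=T+t\mathcal{T}$,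 with $\mathcal{T}:M\to A$ linear, such that $T_t$ is an $\mathcal{O}$-operator on $A$ with respect to $M$ for all $t$. Identities required "for all $t$" are understood as identities of polynomials in $t$ (equality of the coefficients of each power of $t$). A morphism of $\mathcal{O}$-operators from $T$ to $T'$ (both on $A$ with respect to $M$) is a pair $(f,g)$ where $f:A\to A$ is a Hom-associative algebra morphism and $g:M\to M$ is linear with $\phi g=g\phi$, $T'g=fT$, $l(f(x),g(u))=g(l(x,u))$, $r(g(u),f(x))=g(r(u,x))$ for all $x\in A$, $u\in M$. For $x\in A$ write $L_x(y)=x\cdot y$, $R_x(y)=y\cdot x$, $l_x(u)=l(x,u)$, $r_x(u)=r(u,x)$. Two infinitesimal deformations $T^1_t,T^2_t$ of $T$ are equivalent if there is $x\in A$ with $\alpha(x)=x$ such that $(\mathrm{id}_A+t(L_x-R_x),\ \mathrm{id}_M+t(l_x-r_x))$ is a morphism of $\mathcal{O}$-operators from $T^1_t$ to $T^2_t$. $H^1_\alpha(M,A)=Z^1_\alpha(M,A)/B^1_\alpha(M,A)$, where $Z^1_\alpha(M,A)$ is the space of linear maps $f:M\to A$ with $\alpha f=f\phi$ and $T(u)\cdot f(v)+f(u)\cdot T(v)-T(r(u,f(v))+l(f(u),v))-f(r(u,T(v))+l(T(u),v))=0$ for all $u,v\in M$, and $B^1_\alpha(M,A)=\{d_H(a): a\in A,\ \alpha(a)=a\}$ with $d_H(a)(u)=T(u)\cdot a-T(r(u,a))-a\cdot T(u)+T(l(a,u))$. *)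

theory Defs
  imports "HOL-Computational_Algebra.Polynomial"
begin

section \<open>Hom-associative algebras, bimodules and O-operators\<close>

definition bilinear_map ::
  "('k::comm_ring_1 \<Rightarrow> 'a::ab_group_add \<Rightarrow> 'a) \<Rightarrow> ('k \<Rightarrow> 'b::ab_group_add \<Rightarrow> 'b) \<Rightarrow>
   ('k \<Rightarrow> 'c::ab_group_add \<Rightarrow> 'c) \<Rightarrow> ('a \<Rightarrow> 'b \<Rightarrow> 'c) \<Rightarrow> bool" where
  "bilinear_map sA sB sC b \<longleftrightarrow>
     (\<forall>x. module_hom sB sC (\<lambda>y. b x y)) \<and> (\<forall>y. module_hom sA sC (\<lambda>x. b x y))"

locale hom_assoc_algebra = vector_space sA
  for sA :: "'k::field \<Rightarrow> 'a::ab_group_add \<Rightarrow> 'a" +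
  fixes mu :: "'a \<Rightarrow> 'a \<Rightarrow> 'a" and alpha :: "'a \<Rightarrow> 'a"
  assumes mu_bilinear: "bilinear_map sA sA sA mu"
    and alpha_linear: "Vector_Spaces.linear sA sA alpha"
    and alpha_mult: "alpha (mu a b) = mu (alpha a) (alpha b)"
    and hom_assoc: "mu (alpha a) (mu b c) = mu (mu a b) (alpha c)"

locale hom_bimodule = hom_assoc_algebra sA mu alpha + M: vector_space sM
  for sA :: "'k::field \<Rightarrow> 'a::ab_group_add \<Rightarrow> 'a"
    and mu :: "'a \<Rightarrow> 'a \<Rightarrow> 'a" and alpha :: "'a \<Rightarrow> 'a"
    and sM :: "'k \<Rightarrow> 'm::ab_group_add \<Rightarrow> 'm" +
  fixes l :: "'a \<Rightarrow> 'm \<Rightarrow> 'm" and r :: "'m \<Rightarrow> 'a \<Rightarrow> 'm" and phi :: "'m \<Rightarrow> 'm"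
  assumes l_bilinear: "bilinear_map sA sM sM l"
    and r_bilinear: "bilinear_map sM sA sM r"
    and phi_linear: "Vector_Spaces.linear sM sM phi"
    and phi_l: "phi (l x v) = l (alpha x) (phi v)"
    and phi_r: "phi (r v x) = r (phi v) (alpha x)"
    and l_mult: "l (mu x y) (phi v) = l (alpha x) (l y v)"
    and r_mult: "r (phi v) (mu x y) = r (r v x) (alpha y)"
    and l_r: "l (alpha x) (r v y) = r (l x v) (alpha y)"

text \<open>
  The scalars of the next three definitions form a commutative ring, so that the same notions
  apply over the field \<open>K\<close> and, for deformations, over \<open>K[t]\<close>.
\<close>

definition o_operator ::
  "('k::comm_ring_1 \<Rightarrow> 'a::ab_group_add \<Rightarrow> 'a) \<Rightarrow> ('a \<Rightarrow> 'a \<Rightarrow> 'a) \<Rightarrow> ('a \<Rightarrow> 'a) \<Rightarrow>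
   ('k \<Rightarrow> 'm::ab_group_add \<Rightarrow> 'm) \<Rightarrow> ('a \<Rightarrow> 'm \<Rightarrow> 'm) \<Rightarrow> ('m \<Rightarrow> 'a \<Rightarrow> 'm) \<Rightarrow> ('m \<Rightarrow> 'm) \<Rightarrow>
   ('m \<Rightarrow> 'a) \<Rightarrow> bool" where
  "o_operator sA mu alpha sM l r phi T \<longleftrightarrow>
     module_hom sM sA T \<and>
     (\<forall>u. T (phi u) = alpha (T u)) \<and>
     (\<forall>u v. mu (T u) (T v) = T (l (T u) v + r u (T v)))"

definition hom_assoc_morphism ::
  "('k::comm_ring_1 \<Rightarrow> 'a::ab_group_add \<Rightarrow> 'a) \<Rightarrow> ('a \<Rightarrow> 'a \<Rightarrow> 'a) \<Rightarrow> ('a \<Rightarrow> 'a) \<Rightarrow>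
   ('a \<Rightarrow> 'a) \<Rightarrow> bool" where
  "hom_assoc_morphism sA mu alpha f \<longleftrightarrow>
     module_hom sA sA f \<and>
     (\<forall>a. f (alpha a) = alpha (f a)) \<and>
     (\<forall>a b. f (mu a b) = mu (f a) (f b))"

definition o_operator_morphism ::
  "('k::comm_ring_1 \<Rightarrow> 'a::ab_group_add \<Rightarrow> 'a) \<Rightarrow> ('a \<Rightarrow> 'a \<Rightarrow> 'a) \<Rightarrow> ('a \<Rightarrow> 'a) \<Rightarrow>
   ('k \<Rightarrow> 'm::ab_group_add \<Rightarrow> 'm) \<Rightarrow> ('a \<Rightarrow> 'm \<Rightarrow> 'm) \<Rightarrow> ('m \<Rightarrow> 'a \<Rightarrow> 'm) \<Rightarrow> ('m \<Rightarrow> 'm) \<Rightarrow>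
   ('m \<Rightarrow> 'a) \<Rightarrow> ('m \<Rightarrow> 'a) \<Rightarrow> ('a \<Rightarrow> 'a) \<Rightarrow> ('m \<Rightarrow> 'm) \<Rightarrow> bool" where
  "o_operator_morphism sA mu alpha sM l r phi T T' f g \<longleftrightarrow>
     hom_assoc_morphism sA mu alpha f \<and>
     module_hom sM sM g \<and>
     (\<forall>u. phi (g u) = g (phi u)) \<and>
     (\<forall>u. T' (g u) = f (T u)) \<and>
     (\<forall>x u. l (f x) (g u) = g (l x u)) \<and>
     (\<forall>x u. r (g u) (f x) = g (r u x))"

section \<open>Infinitesimal deformations\<close>

text \<open>
  For a vector space \<open>A\<close>, the type \<open>'a poly\<close> is \<open>A[t]\<close>. A bilinear map \<open>b\<close> (in particular the
  action of the scalars) extends to polynomials by \<open>b (x t\<^sup>i) (y t\<^sup>j) = b x y t\<^sup>i\<^sup>+\<^sup>j\<close>.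
\<close>

definition poly_bilin ::
  "('a::zero \<Rightarrow> 'b::zero \<Rightarrow> 'c::comm_monoid_add) \<Rightarrow> 'a poly \<Rightarrow> 'b poly \<Rightarrow> 'c poly" where
  "poly_bilin b p q =
     (\<Sum>i\<le>degree p. \<Sum>j\<le>degree q. monom (b (coeff p i) (coeff q j)) (i + j))"

text \<open>
  The \<open>K[t]\<close>-linear extension of \<open>F + t G\<close>; \<open>pCons 0\<close> is multiplication by \<open>t\<close>.
\<close>

definition affine_family ::
  "('a::zero \<Rightarrow> 'b::comm_monoid_add) \<Rightarrow> ('a \<Rightarrow> 'b) \<Rightarrow> 'a poly \<Rightarrow> 'b poly" where
  "affine_family F G p = map_poly F p + pCons 0 (map_poly G p)"

text \<open>
  Identities required for all \<open>t\<close> are identities of polynomials in \<open>t\<close>: \<open>T + t \<T>\<close> has to be an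
  O-operator for the structure on \<open>A[t]\<close> and \<open>M[t]\<close> obtained by extension of scalars from \<open>K\<close> to
  \<open>K[t]\<close>, and similarly for morphisms. All identities involved are \<open>K[t]\<close>-multilinear, so it is
  the same to impose them on the elements of \<open>A\<close> and \<open>M\<close> only, where they say that the coefficients
  of each power of \<open>t\<close> agree.
\<close>

definition infinitesimal_deformation ::
  "('k::field \<Rightarrow> 'a::ab_group_add \<Rightarrow> 'a) \<Rightarrow> ('a \<Rightarrow> 'a \<Rightarrow> 'a) \<Rightarrow> ('a \<Rightarrow> 'a) \<Rightarrow>
   ('k \<Rightarrow> 'm::ab_group_add \<Rightarrow> 'm) \<Rightarrow> ('a \<Rightarrow> 'm \<Rightarrow> 'm) \<Rightarrow> ('m \<Rightarrow> 'a \<Rightarrow> 'm) \<Rightarrow> ('m \<Rightarrow> 'm) \<Rightarrow>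
   ('m \<Rightarrow> 'a) \<Rightarrow> ('m \<Rightarrow> 'a) \<Rightarrow> bool" where
  "infinitesimal_deformation sA mu alpha sM l r phi T \<T> \<longleftrightarrow>
     Vector_Spaces.linear sM sA \<T> \<and>
     o_operator (poly_bilin sA) (poly_bilin mu) (map_poly alpha)
       (poly_bilin sM) (poly_bilin l) (poly_bilin r) (map_poly phi)
       (affine_family T \<T>)"

definition equivalent_deformations ::
  "('k::field \<Rightarrow> 'a::ab_group_add \<Rightarrow> 'a) \<Rightarrow> ('a \<Rightarrow> 'a \<Rightarrow> 'a) \<Rightarrow> ('a \<Rightarrow> 'a) \<Rightarrow>
   ('k \<Rightarrow> 'm::ab_group_add \<Rightarrow> 'm) \<Rightarrow> ('a \<Rightarrow> 'm \<Rightarrow> 'm) \<Rightarrow> ('m \<Rightarrow> 'a \<Rightarrow> 'm) \<Rightarrow> ('m \<Rightarrow> 'm) \<Rightarrow>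
   ('m \<Rightarrow> 'a) \<Rightarrow> ('m \<Rightarrow> 'a) \<Rightarrow> ('m \<Rightarrow> 'a) \<Rightarrow> bool" where
  "equivalent_deformations sA mu alpha sM l r phi T \<T>1 \<T>2 \<longleftrightarrow>
     (\<exists>x. alpha x = x \<and>
        o_operator_morphism (poly_bilin sA) (poly_bilin mu) (map_poly alpha)
          (poly_bilin sM) (poly_bilin l) (poly_bilin r) (map_poly phi)
          (affine_family T \<T>1) (affine_family T \<T>2)
          (affine_family id (\<lambda>y. mu x y - mu y x))
          (affine_family id (\<lambda>u. l x u - r u x)))"

section \<open>Cohomology\<close>

definition Z1 ::
  "('k::field \<Rightarrow> 'a::ab_group_add \<Rightarrow> 'a) \<Rightarrow> ('a \<Rightarrow> 'a \<Rightarrow> 'a) \<Rightarrow> ('a \<Rightarrow> 'a) \<Rightarrow>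
   ('k \<Rightarrow> 'm::ab_group_add \<Rightarrow> 'm) \<Rightarrow> ('a \<Rightarrow> 'm \<Rightarrow> 'm) \<Rightarrow> ('m \<Rightarrow> 'a \<Rightarrow> 'm) \<Rightarrow> ('m \<Rightarrow> 'm) \<Rightarrow>
   ('m \<Rightarrow> 'a) \<Rightarrow> ('m \<Rightarrow> 'a) set" where
  "Z1 sA mu alpha sM l r phi T =
     {f. Vector_Spaces.linear sM sA f \<and> (\<forall>u. alpha (f u) = f (phi u)) \<and>
         (\<forall>u v. mu (T u) (f v) + mu (f u) (T v)
                 - T (r u (f v) + l (f u) v) - f (r u (T v) + l (T u) v) = 0)}"

definition d_H ::
  "('a::ab_group_add \<Rightarrow> 'a \<Rightarrow> 'a) \<Rightarrow> ('a \<Rightarrow> 'm \<Rightarrow> 'm) \<Rightarrow> ('m \<Rightarrow> 'a \<Rightarrow> 'm) \<Rightarrow>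
   ('m \<Rightarrow> 'a) \<Rightarrow> 'a \<Rightarrow> 'm \<Rightarrow> 'a" where
  "d_H mu l r T a u = mu (T u) a - T (r u a) - mu a (T u) + T (l a u)"

definition B1 ::
  "('a::ab_group_add \<Rightarrow> 'a \<Rightarrow> 'a) \<Rightarrow> ('a \<Rightarrow> 'a) \<Rightarrow> ('a \<Rightarrow> 'm \<Rightarrow> 'm) \<Rightarrow> ('m \<Rightarrow> 'a \<Rightarrow> 'm) \<Rightarrow>
   ('m \<Rightarrow> 'a) \<Rightarrow> ('m \<Rightarrow> 'a) set" where
  "B1 mu alpha l r T = {d_H mu l r T a | a. alpha a = a}"

text \<open>
  The quotient of \<open>Z1\<close> by \<open>B1\<close>: two cocycles are identified when their difference lies in \<open>B1\<close>.
  This is an equivalence relation on \<open>Z1\<close> whether or not every \<open>d_H a\<close> is a cocycle.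
\<close>

definition cohomologous ::
  "('k::field \<Rightarrow> 'a::ab_group_add \<Rightarrow> 'a) \<Rightarrow> ('a \<Rightarrow> 'a \<Rightarrow> 'a) \<Rightarrow> ('a \<Rightarrow> 'a) \<Rightarrow>
   ('k \<Rightarrow> 'm::ab_group_add \<Rightarrow> 'm) \<Rightarrow> ('a \<Rightarrow> 'm \<Rightarrow> 'm) \<Rightarrow> ('m \<Rightarrow> 'a \<Rightarrow> 'm) \<Rightarrow> ('m \<Rightarrow> 'm) \<Rightarrow>
   ('m \<Rightarrow> 'a) \<Rightarrow> (('m \<Rightarrow> 'a) \<times> ('m \<Rightarrow> 'a)) set" where
  "cohomologous sA mu alpha sM l r phi T =
     {(f, g). f \<in> Z1 sA mu alpha sM l r phi T \<and> g \<in> Z1 sA mu alpha sM l r phi T \<and>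
        (\<lambda>u. f u - g u) \<in> B1 mu alpha l r T}"

definition H1 ::
  "('k::field \<Rightarrow> 'a::ab_group_add \<Rightarrow> 'a) \<Rightarrow> ('a \<Rightarrow> 'a \<Rightarrow> 'a) \<Rightarrow> ('a \<Rightarrow> 'a) \<Rightarrow>
   ('k \<Rightarrow> 'm::ab_group_add \<Rightarrow> 'm) \<Rightarrow> ('a \<Rightarrow> 'm \<Rightarrow> 'm) \<Rightarrow> ('m \<Rightarrow> 'a \<Rightarrow> 'm) \<Rightarrow> ('m \<Rightarrow> 'm) \<Rightarrow>
   ('m \<Rightarrow> 'a) \<Rightarrow> ('m \<Rightarrow> 'a) set set" where
  "H1 sA mu alpha sM l r phi T =
     Z1 sA mu alpha sM l r phi T // cohomologous sA mu alpha sM l r phi T"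

definition cohomology_class ::
  "('k::field \<Rightarrow> 'a::ab_group_add \<Rightarrow> 'a) \<Rightarrow> ('a \<Rightarrow> 'a \<Rightarrow> 'a) \<Rightarrow> ('a \<Rightarrow> 'a) \<Rightarrow>
   ('k \<Rightarrow> 'm::ab_group_add \<Rightarrow> 'm) \<Rightarrow> ('a \<Rightarrow> 'm \<Rightarrow> 'm) \<Rightarrow> ('m \<Rightarrow> 'a \<Rightarrow> 'm) \<Rightarrow> ('m \<Rightarrow> 'm) \<Rightarrow>
   ('m \<Rightarrow> 'a) \<Rightarrow> ('m \<Rightarrow> 'a) \<Rightarrow> ('m \<Rightarrow> 'a) set" where
  "cohomology_class sA mu alpha sM l r phi T f = cohomologous sA mu alpha sM l r phi T `` {f}"

end

theory Submission
  imports Defs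
begin

text \<open>
  Both halves of the theorem are the comparison of coefficients of \<open>t\<close> in identities over
  \<open>K[t]\<close>, evaluated at constant polynomials. In the O-operator identity of \<open>T + t \<T>\<close> the constant
  terms say again that \<open>T\<close> is an O-operator, and the coefficients of \<open>t\<close> say that
  \<open>\<T>\<close> is a 1-cocycle (\<open>deformation_in_Z1\<close>). Write \<open>x \<cdot> y\<close> for \<open>mu x y\<close>. If \<open>x\<close> gives the equivalence, the
  compatibility of the two families with the morphism
  \<open>(T + t \<T>2) (u + t (l x u - r u x)) =
   (T u + t \<T>1 u) + t (x \<cdot> (T u + t \<T>1 u) - (T u + t \<T>1 u) \<cdot> x)\<close>
  yields \<open>T (l x u - r u x) + \<T>2 u = \<T>1 u + x \<cdot> T u - T u \<cdot> x\<close> as coefficients of \<open>t\<close>,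
  which is \<open>\<T>1 - \<T>2 = d_H x\<close> (\<open>equivalent_deformations_diff_in_B1\<close>). Two cocycles whose
  difference is a coboundary have the same class because \<open>d_H\<close> is additive in its algebra argument.
\<close>

text \<open>
  This is the Cauchy product formula. Since \<open>b\<close> vanishes at zero, the terms beyond the degrees,
  which involve a zero coefficient, may be added to the defining sum.
\<close>

lemma coeff_poly_bilin:
  assumes b0: "\<And>y. b 0 y = 0" "\<And>x. b x 0 = 0"
  shows "coeff (poly_bilin b p q) n = (\<Sum>i\<le>n. b (coeff p i) (coeff q (n - i)))"
proof -
  let ?f = "\<lambda>i. if i \<le> n then b (coeff p i) (coeff q (n - i)) else 0"
  have inner: "(\<Sum>j\<le>degree q. if i + j = n then b (coeff p i) (coeff q j) else 0) = ?f i" for i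
  proof (cases "i \<le> n")
    case True
    then have "i + j = n \<longleftrightarrow> j = n - i" for j by auto
    then show ?thesis using True b0(2) by (simp add: coeff_eq_0)
  next
    case False
    then show ?thesis by (auto intro: sum.neutral)
  qed
  have "coeff (poly_bilin b p q) n = (\<Sum>i\<le>degree p. ?f i)"
    unfolding poly_bilin_def inner[symmetric] by (simp add: coeff_sum)
  also have "\<dots> = (\<Sum>i\<le>max (degree p) n. ?f i)"
    by (rule sum.mono_neutral_left) (auto simp: coeff_eq_0 b0(1))
  also have "\<dots> = (\<Sum>i\<le>n. ?f i)"
    by (rule sum.mono_neutral_right) auto
  also have "\<dots> = (\<Sum>i\<le>n. b (coeff p i) (coeff q (n - i)))"
    by simp
  finally show ?thesis .
qed

lemma coeff_affine_family:
  assumes "F 0 = 0" "G 0 = 0"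
  shows "coeff (affine_family F G p) n =
    F (coeff p n) + (case n of 0 \<Rightarrow> 0 | Suc m \<Rightarrow> G (coeff p m))"
  using assms by (simp add: affine_family_def coeff_map_poly coeff_pCons split: nat.split)

lemma bilinear_map_additive:
  assumes "bilinear_map sA sB sC b"
  shows "b (x + x') y = b x y + b x' y" "b (x - x') y = b x y - b x' y" "b 0 y = 0"
    and "b x (y + y') = b x y + b x y'" "b x (y - y') = b x y - b x y'" "b x 0 = 0"
proof -
  have h: "module_hom sB sC (\<lambda>y. b x y)" "module_hom sA sC (\<lambda>x. b x y)" for x y
    using assms by (auto simp: bilinear_map_def)
  show "b (x + x') y = b x y + b x' y" "b (x - x') y = b x y - b x' y" "b 0 y = 0"
    using module_hom.add[OF h(2)] module_hom.diff[OF h(2)] module_hom.zero[OF h(2)] by blast+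
  show "b x (y + y') = b x y + b x y'" "b x (y - y') = b x y - b x y'" "b x 0 = 0"
    using module_hom.add[OF h(1)] module_hom.diff[OF h(1)] module_hom.zero[OF h(1)] by blast+
qed

lemma module_hom_additive:
  assumes "module_hom s1 s2 f"
  shows "f (x + y) = f x + f y" "f (x - y) = f x - f y" "f 0 = 0"
  using module_hom.add[OF assms] module_hom.diff[OF assms] module_hom.zero[OF assms] by blast+

lemma linear_imp_module_hom: "Vector_Spaces.linear s1 s2 f \<Longrightarrow> module_hom s1 s2 f"
  by (simp add: Vector_Spaces.linear_iff_module_hom)

context hom_bimodule
begin

lemmas mu_additive = bilinear_map_additive[OF mu_bilinear]
lemmas l_additive = bilinear_map_additive[OF l_bilinear]
lemmas r_additive = bilinear_map_additive[OF r_bilinear]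
lemmas alpha_additive = module_hom_additive[OF linear_imp_module_hom[OF alpha_linear]]
lemmas phi_additive = module_hom_additive[OF linear_imp_module_hom[OF phi_linear]]

text \<open>
  At constants \<open>[:u:]\<close> and \<open>[:v:]\<close> the family takes the values \<open>T u + t \<T> u\<close> and
  \<open>T v + t \<T> v\<close>, so the coefficient of \<open>t\<close> collects the terms in which \<open>\<T>\<close> occurs exactly
  once; the cocycle condition is this linearization of the O-operator identity at \<open>T\<close>.
\<close>

lemma deformation_in_Z1:
  assumes T: "T 0 = 0"
    and D: "infinitesimal_deformation sA mu alpha sM l r phi T \<T>"
  shows "\<T> \<in> Z1 sA mu alpha sM l r phi T"
proof -
  have lin: "Vector_Spaces.linear sM sA \<T>"
    and comm: "affine_family T \<T> (map_poly phi p) = map_poly alpha (affine_family T \<T> p)"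
    and oper: "poly_bilin mu (affine_family T \<T> p) (affine_family T \<T> q) =
      affine_family T \<T> (poly_bilin l (affine_family T \<T> p) q +
        poly_bilin r p (affine_family T \<T> q))" for p q
    using D by (auto simp: infinitesimal_deformation_def o_operator_def)
  have D0: "\<T> 0 = 0" by (rule module_hom_additive(3)[OF linear_imp_module_hom[OF lin]])
  note coeffs = coeff_affine_family[of T \<T>, OF T D0] coeff_map_poly coeff_poly_bilin[of mu]
    coeff_poly_bilin[of l] coeff_poly_bilin[of r] mu_additive l_additive r_additive alpha_additive phi_additive T D0
  have "alpha (\<T> u) = \<T> (phi u)" for u
    using arg_cong[OF comm[of "[:u:]"], of "\<lambda>p. coeff p 1"] by (simp add: coeffs)
  moreover have "mu (T u) (\<T> v) + mu (\<T> u) (T v)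
      - T (r u (\<T> v) + l (\<T> u) v) - \<T> (r u (T v) + l (T u) v) = 0" for u v
    using arg_cong[OF oper[of "[:u:]" "[:v:]"], of "\<lambda>p. coeff p 1"]
    by (simp add: coeffs add.commute)
  ultimately show ?thesis using lin by (simp add: Z1_def)
qed

text \<open>
  The element \<open>x\<close> that gives the equivalence is itself the cochain whose coboundary is the
  difference. The condition \<open>alpha x = x\<close> in the
  notion of equivalence is what places \<open>d_H x\<close> in \<open>B1\<close>.
\<close>

lemma equivalent_deformations_diff_in_B1:
  assumes T: "module_hom sM sA T" and zero: "\<T>1 0 = 0" "\<T>2 0 = 0"
    and equiv: "equivalent_deformations sA mu alpha sM l r phi T \<T>1 \<T>2"
  shows "(\<lambda>u. \<T>1 u - \<T>2 u) \<in> B1 mu alpha l r T"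
proof -
  obtain x where x: "alpha x = x"
    and intertwine: "affine_family T \<T>2 (affine_family id (\<lambda>u. l x u - r u x) p) =
      affine_family id (\<lambda>y. mu x y - mu y x) (affine_family T \<T>1 p)" for p
    using equiv by (auto simp: equivalent_deformations_def o_operator_morphism_def)
  note T_additive = module_hom_additive[OF T]
  have "T (l x u) - T (r u x) + \<T>2 u = \<T>1 u + (mu x (T u) - mu (T u) x)" for u
    using arg_cong[OF intertwine[of "[:u:]"], of "\<lambda>p. coeff p 1"]
    by (simp add: coeff_affine_family T_additive zero mu_additive l_additive r_additive)
  then have "\<T>1 u - \<T>2 u = d_H mu l r T x u" for u
    by (simp add: d_H_def algebra_simps eq_diff_eq diff_eq_eq)
  then show ?thesis using x by (auto simp: B1_def)
qed

text \<open>
  \<open>B1\<close> is an additive group, because \<open>d_H\<close> is additive and \<open>alpha\<close> fixes differences of fixed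
  elements. Closure under differences, together with zero, gives symmetry and transitivity.
\<close>

lemma equiv_cohomologous:
  assumes T: "module_hom sM sA T"
  shows "equiv (Z1 sA mu alpha sM l r phi T) (cohomologous sA mu alpha sM l r phi T)"
proof -
  note T_additive = module_hom_additive[OF T]
  have zero: "(\<lambda>u. 0) \<in> B1 mu alpha l r T"
    unfolding B1_def by (intro CollectI exI[of _ 0]) (auto simp: d_H_def mu_additive l_additive r_additive T_additive alpha_additive)
  have diff: "(\<lambda>u. f u - g u) \<in> B1 mu alpha l r T"
    if fg: "f \<in> B1 mu alpha l r T" "g \<in> B1 mu alpha l r T" for f g
  proof -
    obtain a b where "alpha a = a" "alpha b = b" "f = d_H mu l r T a" "g = d_H mu l r T b"
      using fg by (auto simp: B1_def)
    then show ?thesis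
      unfolding B1_def by (intro CollectI exI[of _ "a - b"])
        (auto simp: d_H_def mu_additive l_additive r_additive T_additive alpha_additive algebra_simps)
  qed
  have sym: "(\<lambda>u. g u - f u) \<in> B1 mu alpha l r T"
    if "(\<lambda>u. f u - g u) \<in> B1 mu alpha l r T" for f g :: "'m \<Rightarrow> 'a"
    using diff[OF zero that] by simp
  have trans: "(\<lambda>u. f u - h u) \<in> B1 mu alpha l r T"
    if "(\<lambda>u. f u - g u) \<in> B1 mu alpha l r T" "(\<lambda>u. g u - h u) \<in> B1 mu alpha l r T"
    for f g h :: "'m \<Rightarrow> 'a"
    using diff[OF that(1) sym[OF that(2)]] by simp
  show ?thesis
    by (rule equivI)
      (auto simp: cohomologous_def refl_on_def zero intro!: symI transI intro: sym trans)
qed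

end

theorem theorem4p7:
  fixes sA :: "'k::field \<Rightarrow> 'a::ab_group_add \<Rightarrow> 'a"
    and mu :: "'a \<Rightarrow> 'a \<Rightarrow> 'a" and alpha :: "'a \<Rightarrow> 'a"
    and sM :: "'k \<Rightarrow> 'm::ab_group_add \<Rightarrow> 'm"
    and l :: "'a \<Rightarrow> 'm \<Rightarrow> 'm" and r :: "'m \<Rightarrow> 'a \<Rightarrow> 'm" and phi :: "'m \<Rightarrow> 'm"
    and T \<T>1 \<T>2 :: "'m \<Rightarrow> 'a"
  assumes "hom_assoc_algebra sA mu alpha"
    and "hom_bimodule sA mu alpha sM l r phi"
    and "o_operator sA mu alpha sM l r phi T"
    and "infinitesimal_deformation sA mu alpha sM l r phi T \<T>1"
    and "infinitesimal_deformation sA mu alpha sM l r phi T \<T>2"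
    and "equivalent_deformations sA mu alpha sM l r phi T \<T>1 \<T>2"
  shows "\<T>1 \<in> Z1 sA mu alpha sM l r phi T \<and> \<T>2 \<in> Z1 sA mu alpha sM l r phi T \<and>
    cohomology_class sA mu alpha sM l r phi T \<T>1 \<in> H1 sA mu alpha sM l r phi T \<and>
    cohomology_class sA mu alpha sM l r phi T \<T>1 = cohomology_class sA mu alpha sM l r phi T \<T>2"
proof -
  interpret hom_bimodule sA mu alpha sM l r phi by fact
  have T: "module_hom sM sA T" using assms(3) by (simp add: o_operator_def)
  note T0 = module_hom_additive(3)[OF T]
  note Z = deformation_in_Z1[OF T0 assms(4)] deformation_in_Z1[OF T0 assms(5)]
  have zero: "\<T>1 0 = 0" "\<T>2 0 = 0"
    using Z by (auto simp: Z1_def dest!: linear_imp_module_hom module_hom_additive(3))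
  have "(\<T>1, \<T>2) \<in> cohomologous sA mu alpha sM l r phi T"
    using Z equivalent_deformations_diff_in_B1[OF T zero assms(6)]
    by (simp add: cohomologous_def)
  then show ?thesis
    using Z equiv_class_eq[OF equiv_cohomologous[OF T]]
    by (auto simp: cohomology_class_def H1_def intro: quotientI)
qed

end
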